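(* Let $w=(w_n)_{n\ge 1}$ be a bounded sequence of positive numbers and let $B_w$ be the associated weighted backward shift. (1) If $1\le p<\infty$ and $B_w$ is strongly hypercyclic on $\ell^p$, then $\sum_{n=1}^\infty\big(\inf_{i\ge 1}M_i^n\big)^p=\infty$. (2) If $B_w$ is strongly hypercyclic on $c_0$, then $\limsup_{n\to\infty}\big(\inf_{i\ge 1}M_i^n\big)>0$.
   Context: Here $c_0$ is the Banach space of complex sequences $x=(x_n)_{n\ge 0}$ with $x_n\to 0$, with the sup norm, and $\ell^p$ is the Banach space of complex sequences $(x_n)_{n\ge 0}$ with $\|x\|=(\sum_{n\ge 0}|x_n|^p)^{1/p}<\infty$. For a bounded sequence $w=(w_n)_{n\ge 1}$ of positive numbers, the weighted backward shift $B_w$ is the continuous linear operator $B_w(x_0,x_1,x_2,\dots)=(w_1x_1,w_2x_2,\dots)$ on $c_0$ or $\ell^p$. For $i,j\ge 1$, $M_i^j=w_iw_{i+1}\cdots w_{i+j-1}$ (product of $j$ consecutive weights starting at $w_i$). A continuous linear operator $T$ on a space $X$ is strongly hypercyclic if, for each non-empty open subset $U$ of $X$, $X\setminus\{0\}\subseteq\bigcup_{n=0}^\infty T^n(U)$. *)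

theory Defs
  imports "HOL-Analysis.Analysis" "HOL-Library.Function_Algebras"
begin

section \<open>The sequence spaces\<close>

text \<open>The guard makes this a metric in the sense of \<^locale>\<open>Metric_space\<close>, which asks for
  nonnegativity and symmetry of the distance on the whole type; outside \<open>X\<close> the value
  \<open>N (x - y)\<close> may be meaningless. The topology only sees points of \<open>X\<close>.\<close>

definition norm_dist ::
    "'a set \<Rightarrow> ('a \<Rightarrow> real) \<Rightarrow> 'a \<Rightarrow> 'a::ab_group_add \<Rightarrow> real" where
  "norm_dist X N x y = (if x \<in> X \<and> y \<in> X then N (x - y) else 0)"

definition norm_topology :: "'a set \<Rightarrow> ('a \<Rightarrow> real) \<Rightarrow> 'a::ab_group_add topology" where
  "norm_topology X N = Metric_space.mtopology X (norm_dist X N)"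

definition c0_space :: "(nat \<Rightarrow> complex) set" where
  "c0_space = {x. x \<longlonglongrightarrow> 0}"

definition c0_norm :: "(nat \<Rightarrow> complex) \<Rightarrow> real" where
  "c0_norm x = (SUP n. norm (x n))"

definition lp_space :: "real \<Rightarrow> (nat \<Rightarrow> complex) set" where
  "lp_space p = {x. summable (\<lambda>n. norm (x n) powr p)}"

definition lp_norm :: "real \<Rightarrow> (nat \<Rightarrow> complex) \<Rightarrow> real" where
  "lp_norm p x = (\<Sum>n. norm (x n) powr p) powr (1 / p)"

abbreviation c0_topology :: "(nat \<Rightarrow> complex) topology" where
  "c0_topology \<equiv> norm_topology c0_space c0_norm"

abbreviation lp_topology :: "real \<Rightarrow> (nat \<Rightarrow> complex) topology" where
  "lp_topology p \<equiv> norm_topology (lp_space p) (lp_norm p)"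


section \<open>Weighted backward shifts and strong hypercyclicity\<close>

text \<open>Weights are indexed from 1; the value \<open>w 0\<close> is never used.\<close>

definition backward_shift :: "(nat \<Rightarrow> real) \<Rightarrow> (nat \<Rightarrow> complex) \<Rightarrow> nat \<Rightarrow> complex" where
  "backward_shift w x n = complex_of_real (w (Suc n)) * x (Suc n)"

definition weight_prod :: "(nat \<Rightarrow> real) \<Rightarrow> nat \<Rightarrow> nat \<Rightarrow> real" where
  "weight_prod w i j = (\<Prod>k\<in>{i..<i + j}. w k)"

text \<open>The notion is meant for continuous linear self-maps of \<open>topspace X\<close>; that weighted
  backward shifts are such maps on the spaces above is proved below.\<close>

definition strongly_hypercyclic :: "'a::zero topology \<Rightarrow> ('a \<Rightarrow> 'a) \<Rightarrow> bool" where
  "strongly_hypercyclic X T \<longleftrightarrow>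
     (\<forall>U. openin X U \<and> U \<noteq> {} \<longrightarrow> topspace X - {0} \<subseteq> (\<Union>n. (T ^^ n) ` U))"


section \<open>The spaces are normed spaces\<close>

lemma Metric_space_norm_dist:
  assumes diff: "\<And>x y. x \<in> X \<Longrightarrow> y \<in> X \<Longrightarrow> x - y \<in> X"
    and nn: "\<And>x. x \<in> X \<Longrightarrow> N x \<ge> 0"
    and z: "\<And>x. x \<in> X \<Longrightarrow> N x = 0 \<longleftrightarrow> x = 0"
    and neg: "\<And>x. N (- x) = N x"
    and tri: "\<And>x y. x \<in> X \<Longrightarrow> y \<in> X \<Longrightarrow> N (x + y) \<le> N x + N y"
  shows "Metric_space X (norm_dist X N)"
proof
  fix x y show "0 \<le> norm_dist X N x y" by (auto simp: norm_dist_def nn diff)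
next
  fix x y show "norm_dist X N x y = norm_dist X N y x"
    using neg[of "x - y"] by (simp add: norm_dist_def)
next
  fix x y assume "x \<in> X" "y \<in> X" then show "(norm_dist X N x y = 0) = (x = y)"
    by (simp add: norm_dist_def z diff)
next
  fix x y u assume "x \<in> X" "y \<in> X" "u \<in> X"
  then show "norm_dist X N x u \<le> norm_dist X N x y + norm_dist X N y u"
    using tri[of "x - y" "y - u"] by (simp add: norm_dist_def diff)
qed

lemma c0_norm_upper: "x \<in> c0_space \<Longrightarrow> norm (x n) \<le> c0_norm x"
proof -
  assume "x \<in> c0_space"
  then have "Bseq x" by (auto simp: c0_space_def intro: convergent_imp_Bseq convergentI)
  then have "bdd_above (range (\<lambda>n. norm (x n)))"
    by (auto simp: Bseq_def bdd_above_def)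
  then show ?thesis unfolding c0_norm_def by (rule cSUP_upper[OF UNIV_I])
qed

lemma c0_norm_least: "(\<And>n. norm (x n) \<le> C) \<Longrightarrow> c0_norm x \<le> C"
  unfolding c0_norm_def by (rule cSUP_least) auto

theorem Metric_space_c0: "Metric_space c0_space (norm_dist c0_space c0_norm)"
proof (rule Metric_space_norm_dist)
  fix x y assume x: "x \<in> c0_space"
  have 0: "0 \<le> c0_norm x" using norm_ge_zero c0_norm_upper[OF x] order_trans by blast
  then show "c0_norm x \<ge> 0" .
  have "c0_norm x = 0 \<Longrightarrow> x n = 0" for n using c0_norm_upper[OF x, of n] by simp
  moreover have "c0_norm 0 \<le> 0" by (rule c0_norm_least) simp
  ultimately show "c0_norm x = 0 \<longleftrightarrow> x = 0" using 0 by (auto intro: ext)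
  assume y: "y \<in> c0_space"
  from x y show "x - y \<in> c0_space"
    using tendsto_diff[of x 0 sequentially y 0] by (simp add: c0_space_def fun_diff_def)
  show "c0_norm (x + y) \<le> c0_norm x + c0_norm y"
    by (rule c0_norm_least)
      (use norm_triangle_le[OF add_mono[OF c0_norm_upper[OF x] c0_norm_upper[OF y]]] in simp)
next
  fix x show "c0_norm (- x) = c0_norm x" by (simp add: c0_norm_def fun_Compl_def)
qed

lemma powr_convex_nonneg:
  fixes a b :: real
  assumes "p \<ge> 1" "a \<ge> 0" "b \<ge> 0" "0 \<le> t" "t \<le> 1"
  shows "(t * a + (1 - t) * b) powr p \<le> t * a powr p + (1 - t) * b powr p"
proof -
  have le: "s powr p \<le> s" if "0 \<le> s" "s \<le> 1" for s :: real
    using powr_mono'[of 1 p s] that assms(1) by auto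
  consider "a > 0" "b > 0" | "a = 0" | "b = 0" using assms by linarith
  then show ?thesis
  proof cases
    case 1
    then show ?thesis
      using convex_onD[OF powr_convex[OF assms(1)], of "1 - t" a b] assms by simp
  next
    case 2
    then show ?thesis
      using mult_right_mono[OF le[of "1 - t"], of "b powr p"] assms by (simp add: powr_mult)
  next
    case 3
    then show ?thesis
      using mult_right_mono[OF le[of t], of "a powr p"] assms by (simp add: powr_mult)
  qed
qed

lemma lp_norm_nonneg: "lp_norm p x \<ge> 0"
  by (simp add: lp_norm_def)

lemma lp_norm_powr:
  assumes "p \<ge> 1" "x \<in> lp_space p"
  shows "lp_norm p x powr p = (\<Sum>n. norm (x n) powr p)"
  using assms suminf_nonneg[of "\<lambda>n. norm (x n) powr p"]
  by (simp add: lp_norm_def lp_space_def powr_powr)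

lemma lp_norm_eq_0:
  assumes "p \<ge> 1" "x \<in> lp_space p"
  shows "lp_norm p x = 0 \<longleftrightarrow> x = 0"
proof -
  have "lp_norm p x = 0 \<longleftrightarrow> (\<Sum>n. norm (x n) powr p) = 0" by (simp add: lp_norm_def)
  also have "\<dots> \<longleftrightarrow> (\<forall>n. norm (x n) powr p = 0)"
    using assms(2) by (intro suminf_eq_zero_iff) (auto simp: lp_space_def)
  finally show ?thesis by (auto simp: fun_eq_iff)
qed

lemma lp_norm_triangle:
  assumes p: "p \<ge> 1" and x: "x \<in> lp_space p" and y: "y \<in> lp_space p"
  shows "x + y \<in> lp_space p" and "lp_norm p (x + y) \<le> lp_norm p x + lp_norm p y"
proof -
  define A B where "A = lp_norm p x" and "B = lp_norm p y"
  have AB: "A \<ge> 0" "B \<ge> 0" by (auto simp: A_def B_def lp_norm_nonneg)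
  have "x + y \<in> lp_space p \<and> lp_norm p (x + y) \<le> A + B"
  proof (cases "A = 0 \<or> B = 0")
    case True
    then have "x = 0 \<or> y = 0" using lp_norm_eq_0 p x y by (simp add: A_def B_def)
    then show ?thesis using x y AB by (auto simp: A_def B_def)
  next
    case False
    then have pos: "A > 0" "B > 0" using AB by auto
    define t where "t = A / (A + B)"
    have t: "0 \<le> t" "t \<le> 1" "1 - t = B / (A + B)" using pos by (auto simp: t_def field_simps)
    let ?f = "\<lambda>n. t * (norm (x n) powr p / A powr p) + (1 - t) * (norm (y n) powr p / B powr p)"
    have b: "norm ((x + y) n) powr p \<le> (A + B) powr p * ?f n" for n
    proof -
      have "norm ((x + y) n) \<le> norm (x n) + norm (y n)" by (simp add: norm_triangle_ineq)
      also have "\<dots> = (A + B) * (t * (norm (x n) / A) + (1 - t) * (norm (y n) / B))"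
        unfolding t(3) using pos by (simp add: t_def distrib_left)
      finally have "norm ((x + y) n) powr p
          \<le> ((A + B) * (t * (norm (x n) / A) + (1 - t) * (norm (y n) / B))) powr p"
        using p by (intro powr_mono2) auto
      also have "\<dots> = (A + B) powr p * (t * (norm (x n) / A) + (1 - t) * (norm (y n) / B)) powr p"
        using pos t by (intro powr_mult)
      also have "\<dots> \<le> (A + B) powr p * ?f n"
        using powr_convex_nonneg[OF p, of "norm (x n) / A" "norm (y n) / B" t] pos t(1,2)
        by (intro mult_left_mono) (auto simp: powr_divide)
      finally show ?thesis .
    qed
    have "(\<lambda>n. norm (x n) powr p) sums (A powr p)" "(\<lambda>n. norm (y n) powr p) sums (B powr p)"
      using x y lp_norm_powr[OF p x] lp_norm_powr[OF p y]
      by (auto simp: A_def B_def lp_space_def summable_sums)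
    then have "?f sums (t * (A powr p / A powr p) + (1 - t) * (B powr p / B powr p))"
      by (intro sums_add sums_mult sums_divide)
    then have "?f sums 1" using pos by simp
    then have s: "(\<lambda>n. (A + B) powr p * ?f n) sums ((A + B) powr p)"
      using sums_mult[of ?f 1 "(A + B) powr p"] by simp
    have m: "summable (\<lambda>n. norm ((x + y) n) powr p)"
      by (rule summable_comparison_test'[OF sums_summable[OF s], of 0]) (use b in simp)
    then have "(\<Sum>n. norm ((x + y) n) powr p) \<le> (A + B) powr p"
      using suminf_le[OF b m sums_summable[OF s]] sums_unique[OF s] by simp
    then have "lp_norm p (x + y) \<le> ((A + B) powr p) powr (1 / p)"
      unfolding lp_norm_def using p suminf_nonneg[OF m] by (intro powr_mono2) auto
    also have "\<dots> = A + B" using p pos by (simp add: powr_powr)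
    finally show ?thesis using m by (simp add: lp_space_def)
  qed
  then show "x + y \<in> lp_space p" "lp_norm p (x + y) \<le> lp_norm p x + lp_norm p y"
    by (auto simp: A_def B_def)
qed

theorem Metric_space_lp:
  assumes p: "p \<ge> 1"
  shows "Metric_space (lp_space p) (norm_dist (lp_space p) (lp_norm p))"
proof (rule Metric_space_norm_dist)
  fix x y assume x: "x \<in> lp_space p" and y: "y \<in> lp_space p"
  have "- y \<in> lp_space p" using y by (simp add: lp_space_def)
  from lp_norm_triangle(1)[OF p x this] show "x - y \<in> lp_space p" by simp
qed (use lp_norm_triangle[OF p] lp_norm_eq_0[OF p] in \<open>simp_all add: lp_norm_nonneg lp_norm_def\<close>)

lemma topspace_c0: "topspace c0_topology = c0_space"
  by (simp add: norm_topology_def Metric_space.topspace_mtopology[OF Metric_space_c0])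

lemma topspace_lp: "p \<ge> 1 \<Longrightarrow> topspace (lp_topology p) = lp_space p"
  by (simp add: norm_topology_def Metric_space.topspace_mtopology[OF Metric_space_lp])


section \<open>Weighted backward shifts are continuous linear operators\<close>

lemma backward_shift_linear:
  "backward_shift w (\<lambda>n. a * x n + b * y n)
     = (\<lambda>n. a * backward_shift w x n + b * backward_shift w y n)"
  by (simp add: backward_shift_def fun_eq_iff algebra_simps)

lemma backward_shift_diff: "backward_shift w (x - y) = backward_shift w x - backward_shift w y"
  by (simp add: backward_shift_def fun_eq_iff algebra_simps)

lemma norm_topology_continuous:
  assumes M: "Metric_space X (norm_dist X N)"
    and diff: "\<And>x y. x \<in> X \<Longrightarrow> y \<in> X \<Longrightarrow> x - y \<in> X"
    and T: "\<And>x. x \<in> X \<Longrightarrow> T x \<in> X" "\<And>x. x \<in> X \<Longrightarrow> N (T x) \<le> C * N x"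
    and lin: "\<And>x y. T (x - y) = T x - T y"
  shows "continuous_map (norm_topology X N) (norm_topology X N) T"
proof -
  interpret Metric_space X "norm_dist X N" by (rule M)
  have m: "mspace (metric (X, norm_dist X N)) = X" "mdist (metric (X, norm_dist X N)) = norm_dist X N"
    by simp_all
  have "Lipschitz_continuous_map (metric (X, norm_dist X N)) (metric (X, norm_dist X N)) T"
    unfolding Lipschitz_continuous_map_def m
    using T diff lin by (auto simp: norm_dist_def intro!: exI[of _ C] simp flip: lin)
  from Lipschitz_continuous_imp_continuous_map[OF this] show ?thesis by (simp add: norm_topology_def)
qed

lemma weights_bounded:
  assumes "\<forall>n\<ge>1. w n > (0::real)" "bounded (w ` {1..})"
  obtains C where "C \<ge> 0" "\<And>n. \<bar>w (Suc n)\<bar> \<le> C"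
proof -
  obtain C where C: "\<And>v. v \<in> w ` {1..} \<Longrightarrow> \<bar>v\<bar> \<le> C"
    using assms(2) by (auto simp: bounded_iff)
  then have C': "\<bar>w (Suc n)\<bar> \<le> C" for n by auto
  moreover have "0 \<le> C" using C'[of 0] by linarith
  ultimately show ?thesis using that by blast
qed

theorem continuous_map_backward_shift_c0:
  assumes "\<forall>n\<ge>1. w n > (0::real)" "bounded (w ` {1..})"
  shows "continuous_map c0_topology c0_topology (backward_shift w)"
proof -
  obtain C where C: "C \<ge> 0" "\<And>n. \<bar>w (Suc n)\<bar> \<le> C" using weights_bounded[OF assms] by blast
  show ?thesis
  proof (rule norm_topology_continuous[OF Metric_space_c0])
    fix x y assume x: "x \<in> c0_space"
    have le: "norm (backward_shift w x n) \<le> C * norm (x (Suc n))" for n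
      using C(2)[of n] by (auto simp: backward_shift_def norm_mult intro: mult_right_mono)
    have "(\<lambda>n. C * norm (x (Suc n))) \<longlonglongrightarrow> 0"
      using x LIMSEQ_Suc[of x 0] by (auto simp: c0_space_def intro!: tendsto_mult_right_zero tendsto_norm_zero)
    then have "backward_shift w x \<longlonglongrightarrow> 0"
      by (rule Lim_null_comparison[rotated]) (use le in auto)
    then show "backward_shift w x \<in> c0_space" by (simp add: c0_space_def)
    show "c0_norm (backward_shift w x) \<le> C * c0_norm x"
      by (rule c0_norm_least) (use le mult_left_mono[OF c0_norm_upper[OF x] C(1)] order_trans in blast)
    assume "y \<in> c0_space" then show "x - y \<in> c0_space"
      using x tendsto_diff[of x 0 sequentially y 0] by (simp add: c0_space_def fun_diff_def)
  qed (rule backward_shift_diff)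
qed

theorem continuous_map_backward_shift_lp:
  assumes p: "p \<ge> 1" and w: "\<forall>n\<ge>1. w n > (0::real)" "bounded (w ` {1..})"
  shows "continuous_map (lp_topology p) (lp_topology p) (backward_shift w)"
proof -
  obtain C where C: "C \<ge> 0" "\<And>n. \<bar>w (Suc n)\<bar> \<le> C" using weights_bounded[OF w] by blast
  show ?thesis
  proof (rule norm_topology_continuous[OF Metric_space_lp[OF p]])
    fix x y assume x: "x \<in> lp_space p"
    let ?g = "\<lambda>n. norm (x n) powr p"
    have sg: "summable ?g" using x by (simp add: lp_space_def)
    have le: "norm (backward_shift w x n) powr p \<le> C powr p * ?g (Suc n)" for n
    proof -
      have "norm (backward_shift w x n) \<le> C * norm (x (Suc n))"
        using C(2)[of n] by (auto simp: backward_shift_def norm_mult intro: mult_right_mono)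
      then have "norm (backward_shift w x n) powr p \<le> (C * norm (x (Suc n))) powr p"
        using p by (intro powr_mono2) auto
      then show ?thesis using C(1) by (simp add: powr_mult)
    qed
    have s: "summable (\<lambda>n. C powr p * ?g (Suc n))"
      using sg summable_Suc_iff[of ?g] by (intro summable_mult) simp
    have m: "summable (\<lambda>n. norm (backward_shift w x n) powr p)"
      by (rule summable_comparison_test'[OF s, of 0]) (use le in simp)
    then show "backward_shift w x \<in> lp_space p" by (simp add: lp_space_def)
    have "(\<Sum>n. norm (backward_shift w x n) powr p) \<le> (\<Sum>n. C powr p * ?g (Suc n))"
      by (rule suminf_le[OF le m s])
    also have "\<dots> = C powr p * (\<Sum>n. ?g (Suc n))"
      using sg summable_Suc_iff[of ?g] by (intro suminf_mult) simp
    also have "\<dots> \<le> C powr p * (\<Sum>n. ?g n)"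
      using suminf_split_head[OF sg] by (intro mult_left_mono) auto
    finally have "lp_norm p (backward_shift w x) \<le> (C powr p * (\<Sum>n. ?g n)) powr (1 / p)"
      unfolding lp_norm_def using p suminf_nonneg[OF m] by (intro powr_mono2) auto
    also have "\<dots> = C * lp_norm p x"
      using p C(1) suminf_nonneg[OF sg] by (simp add: lp_norm_def powr_mult powr_powr)
    finally show "lp_norm p (backward_shift w x) \<le> C * lp_norm p x" .
    assume "y \<in> lp_space p"
    then have "- y \<in> lp_space p" by (simp add: lp_space_def)
    from lp_norm_triangle(1)[OF p x this] show "x - y \<in> lp_space p" by simp
  qed (rule backward_shift_diff)
qed

end

theory Submission
  imports Defs
begin

text \<open>Write \<open>a n\<close> for the infimum over \<open>i\<close> of the products \<open>M i n\<close> of \<open>n\<close> consecutive weights.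
  A solution \<open>x\<close> of \<open>B\<^sup>n x = y\<close> is forced to have \<open>x (k + n) = y k / M (k + 1) n\<close>. So if some \<open>y\<close>
  satisfies, for every \<open>n\<close>, the inequality \<open>\<bar>y k\<bar> \<ge> M (k + 1) n\<close> at some index \<open>k = \<kappa> n\<close>, then
  every preimage of \<open>y\<close> under every power of \<open>B\<close> has an entry of modulus at least 1, and \<open>y\<close> is
  reached from no point of the open unit ball: \<open>B\<close> is not strongly hypercyclic
  (\<open>not_strongly_hypercyclic_if_dominating\<close>).

  Both parts are proved by contraposition: if \<open>a\<close> lies in the sequence space, then so does such a
  vector \<open>y\<close>. The infimum need not be attained, so \<open>a\<close> is replaced by \<open>b n = a n + (1/2)\<^sup>n\<close>, which
  still lies in the space and leaves room to choose \<open>\<kappa> n\<close> with \<open>M (\<kappa> n + 1) n < b n\<close>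
  (\<open>ex_weight_prod_near_INF\<close>). What remains is to find \<open>y\<close> in the space with
  \<open>\<bar>y (\<kappa> n)\<bar> \<ge> b n\<close> for all \<open>n\<close>. As \<open>\<kappa>\<close> need not be injective, the entries of \<open>b\<close> cannot
  simply be moved to new places; those that land on the same index are combined, through the
  \<open>p\<close>-th power sum in \<open>\<ell>\<^sup>p\<close> and the supremum in \<open>c\<^sub>0\<close> (\<open>lp_dominates_along_map\<close>,
  \<open>c0_dominates_along_map\<close>).\<close>

lemma backward_shift_funpow:
  "(backward_shift w ^^ n) x k = complex_of_real (weight_prod w (Suc k) n) * x (k + n)"
proof (induction n arbitrary: k)
  case 0
  then show ?case by (simp add: weight_prod_def)
next
  case (Suc n)
  have "{Suc k..<Suc k + Suc n} = insert (Suc k) {Suc (Suc k)..<Suc (Suc k) + n}" by auto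
  then have "weight_prod w (Suc k) (Suc n) = w (Suc k) * weight_prod w (Suc (Suc k)) n"
    by (simp add: weight_prod_def)
  moreover have "(backward_shift w ^^ Suc n) x k =
      complex_of_real (w (Suc k)) * (backward_shift w ^^ n) x (Suc k)"
    unfolding funpow.simps o_apply by (subst backward_shift_def) (rule refl)
  ultimately show ?case by (simp add: Suc.IH)
qed

lemma weight_prod_pos:
  assumes "\<forall>n\<ge>1. w n > (0::real)" "i \<ge> 1"
  shows "weight_prod w i n > 0"
  unfolding weight_prod_def using assms by (intro prod_pos) auto

lemma INF_weight_prod_nonneg:
  assumes "\<forall>n\<ge>1. w n > (0::real)"
  shows "(INF i\<in>{1..}. weight_prod w i n) \<ge> 0"
  using weight_prod_pos[OF assms] by (intro cINF_greatest) (auto intro: less_imp_le)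

lemma ex_weight_prod_near_INF:
  assumes w: "\<forall>n\<ge>1. w n > (0::real)"
  obtains \<kappa> where
    "\<And>n. weight_prod w (Suc (\<kappa> n)) n < (INF i\<in>{1..}. weight_prod w i n) + (1/2) ^ n"
proof -
  have "\<exists>k. weight_prod w (Suc k) n < (INF i\<in>{1..}. weight_prod w i n) + (1/2) ^ n" for n
  proof -
    have bdd: "bdd_below ((\<lambda>i. weight_prod w i n) ` {1..})"
      using weight_prod_pos[OF w] by (intro bdd_belowI[of _ 0]) (auto intro: less_imp_le)
    obtain i where "i \<ge> 1" "weight_prod w i n < (INF i\<in>{1..}. weight_prod w i n) + (1/2) ^ n"
      using cINF_less_iff[OF _ bdd, of "(INF i\<in>{1..}. weight_prod w i n) + (1/2) ^ n"] by auto
    then show ?thesis by (intro exI[of _ "i - 1"]) simp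
  qed
  then show ?thesis using that by metis
qed

text \<open>For any norm that controls each coordinate, the open unit ball witnesses the failure: no power
  of the shift maps a point of it to \<open>y\<close>. The case \<open>n = 0\<close> of the hypothesis, where the product is
  empty, says that \<open>y\<close> itself is outside the ball.\<close>

lemma not_strongly_hypercyclic_if_dominating:
  assumes M: "Metric_space X (norm_dist X N)"
    and zero_in: "0 \<in> X"
    and coord: "\<And>x k. x \<in> X \<Longrightarrow> norm (x k) \<le> N x"
    and w: "\<forall>n\<ge>1. w n > (0::real)"
    and y: "y \<in> X"
    and dom: "\<And>n. \<exists>k. norm (y k) \<ge> weight_prod w (Suc k) n"
  shows "\<not> strongly_hypercyclic (norm_topology X N) (backward_shift w)"
proof
  assume hyp: "strongly_hypercyclic (norm_topology X N) (backward_shift w)"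
  interpret Metric_space X "norm_dist X N" by (rule M)
  have top: "norm_topology X N = mtopology" by (simp add: norm_topology_def)
  obtain k where "norm (y k) \<ge> weight_prod w (Suc k) 0" using dom by blast
  then have "y k \<noteq> 0" using weight_prod_pos[OF w, of "Suc k" 0] by auto
  then have "y \<in> topspace mtopology - {0}" using y by auto
  moreover have "openin mtopology (mball 0 1)" by simp
  moreover have "0 \<in> mball 0 1" using zero_in by simp
  ultimately obtain n x where x: "x \<in> mball 0 1" and yx: "y = (backward_shift w ^^ n) x"
    using hyp unfolding strongly_hypercyclic_def top by blast
  from x have xX: "x \<in> X" and "norm_dist X N x 0 < 1" by (auto simp: commute)
  then have Nx: "N x < 1" using zero_in by (simp add: norm_dist_def)
  obtain k where k: "norm (y k) \<ge> weight_prod w (Suc k) n" using dom by blast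
  have pos: "weight_prod w (Suc k) n > 0" by (rule weight_prod_pos[OF w]) simp
  have "norm (y k) = weight_prod w (Suc k) n * norm (x (k + n))"
    using pos by (simp add: yx backward_shift_funpow norm_mult)
  with k pos have "1 \<le> norm (x (k + n))" by simp
  with coord[OF xX, of "k + n"] Nx show False by simp
qed

lemma lp_norm_upper:
  assumes p: "p \<ge> 1" and x: "x \<in> lp_space p"
  shows "norm (x k) \<le> lp_norm p x"
proof -
  have "norm (x k) powr p \<le> (\<Sum>n. norm (x n) powr p)"
    using sum_le_suminf[of "\<lambda>n. norm (x n) powr p" "{k}"] x by (simp add: lp_space_def)
  also have "\<dots> = lp_norm p x powr p" using lp_norm_powr[OF p x] by simp
  finally show ?thesis
    using p powr_less_mono2[of p "lp_norm p x" "norm (x k)"] lp_norm_nonneg[of p x]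
    by (meson less_le_trans not_less zero_less_one)
qed

text \<open>The \<open>p\<close>-th powers of the \<open>b n\<close> with \<open>\<kappa> n = k\<close> are added up to form the \<open>p\<close>-th power of
  \<open>y k\<close>; since the fibres of \<open>\<kappa>\<close> are disjoint, this does not increase the total sum.\<close>

lemma lp_dominates_along_map:
  fixes b :: "nat \<Rightarrow> real" and \<kappa> :: "nat \<Rightarrow> nat"
  assumes p: "p \<ge> 1" and b: "\<And>n. b n \<ge> 0" and s: "summable (\<lambda>n. b n powr p)"
  shows "\<exists>y\<in>lp_space p. \<forall>n. b n \<le> norm (y (\<kappa> n))"
proof (intro bexI allI)
  let ?g = "\<lambda>k n. if \<kappa> n = k then b n powr p else 0"
  define y where "y k = complex_of_real ((\<Sum>n. ?g k n) powr (1 / p))" for k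
  have sg: "summable (?g k)" for k
    by (rule summable_comparison_test'[OF s, of 0]) auto
  have nn: "(\<Sum>n. ?g k n) \<ge> 0" for k by (rule suminf_nonneg[OF sg]) auto
  have ny: "norm (y k) powr p = (\<Sum>n. ?g k n)" for k
    using p nn[of k] by (simp add: y_def powr_powr)
  have "(\<Sum>k<K. norm (y k) powr p) \<le> (\<Sum>n. b n powr p)" for K
  proof -
    have "(\<Sum>k<K. norm (y k) powr p) = (\<Sum>n. \<Sum>k<K. ?g k n)"
      unfolding ny by (rule suminf_sum[symmetric]) (rule sg)
    also have "\<dots> \<le> (\<Sum>n. b n powr p)"
      by (rule suminf_le[OF _ summable_sum[OF sg] s]) (simp add: sum.delta')
    finally show ?thesis .
  qed
  then have "summable (\<lambda>k. norm (y k) powr p)"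
    by (intro summableI_nonneg_bounded) auto
  then show "y \<in> lp_space p" by (simp add: lp_space_def)
  fix n
  have "b n powr p \<le> (\<Sum>m. ?g (\<kappa> n) m)"
    using sum_le_suminf[OF sg, of "{n}" "\<kappa> n"] by simp
  then have "(b n powr p) powr (1 / p) \<le> (\<Sum>m. ?g (\<kappa> n) m) powr (1 / p)"
    using p by (intro powr_mono2) auto
  then show "b n \<le> norm (y (\<kappa> n))" using p b[of n] by (simp add: y_def powr_powr)
qed

text \<open>Only finitely many \<open>b n\<close> exceed a given \<open>\<epsilon>\<close>, so \<open>\<kappa>\<close> sends them to finitely many indices;
  elsewhere the suprema over the fibres of \<open>\<kappa>\<close> are at most \<open>\<epsilon>\<close>.\<close>

lemma c0_dominates_along_map:
  fixes b :: "nat \<Rightarrow> real" and \<kappa> :: "nat \<Rightarrow> nat"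
  assumes b: "\<And>n. b n \<ge> 0" and lim: "b \<longlonglongrightarrow> 0"
  shows "\<exists>y\<in>c0_space. \<forall>n. b n \<le> norm (y (\<kappa> n))"
proof (intro bexI allI)
  let ?g = "\<lambda>k n. if \<kappa> n = k then b n else 0"
  define s where "s k = (SUP n. ?g k n)" for k
  have "bdd_above (range b)"
    using lim by (intro Bseq_bdd_above convergent_imp_Bseq) (rule convergentI)
  then obtain C where C: "\<And>n. b n \<le> C" by (auto simp: bdd_above_def)
  have bdd: "bdd_above (range (?g k))" for k
    using C b order_trans[OF b C] by (intro bdd_aboveI[of _ C]) auto
  have up: "?g k n \<le> s k" for k n
    unfolding s_def by (rule cSUP_upper[OF UNIV_I bdd])
  have s0: "s k \<ge> 0" for k
    by (rule order_trans[OF _ up[of 0 k]]) (simp add: b)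
  have "s \<longlonglongrightarrow> 0"
  proof (rule LIMSEQ_I)
    fix \<epsilon> :: real assume e: "\<epsilon> > 0"
    obtain m where m: "\<And>n. n \<ge> m \<Longrightarrow> norm (b n - 0) < \<epsilon> / 2"
      using LIMSEQ_D[OF lim, of "\<epsilon> / 2"] e by auto
    have "norm (s k - 0) < \<epsilon>" if k: "k \<ge> Suc (\<Sum>n<m. \<kappa> n)" for k
    proof -
      have "?g k n \<le> \<epsilon> / 2" for n
      proof (cases "n < m")
        case True
        then have "\<kappa> n \<le> (\<Sum>n<m. \<kappa> n)" by (intro member_le_sum) auto
        then show ?thesis using k e by auto
      next
        case False
        then show ?thesis using m[of n] e by auto
      qed
      then have "s k \<le> \<epsilon> / 2" unfolding s_def by (intro cSUP_least) auto
      then show ?thesis using s0[of k] e by simp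
    qed
    then show "\<exists>no. \<forall>n\<ge>no. norm (s n - 0) < \<epsilon>" by blast
  qed
  then show "(\<lambda>k. complex_of_real (s k)) \<in> c0_space"
    using tendsto_of_real[of s 0 sequentially, where ?'a = complex] by (simp add: c0_space_def)
  show "b n \<le> norm (complex_of_real (s (\<kappa> n)))" for n
    using up[of n "\<kappa> n"] s0[of "\<kappa> n"] by simp
qed

theorem proposition2p10:
  fixes w :: "nat \<Rightarrow> real"
  assumes "\<forall>n\<ge>1. w n > 0"
    and "bounded (w ` {1..})"
  shows "(\<forall>p::real. 1 \<le> p \<longrightarrow> strongly_hypercyclic (lp_topology p) (backward_shift w) \<longrightarrow>
            (\<Sum>n. ennreal ((INF i\<in>{1..}. weight_prod w i (Suc n)) powr p)) = \<infinity>) \<and>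
         (strongly_hypercyclic c0_topology (backward_shift w) \<longrightarrow>
            limsup (\<lambda>n. ereal (INF i\<in>{1..}. weight_prod w i n)) > 0)"
proof -
  define a where "a n = (INF i\<in>{1..}. weight_prod w i n)" for n
  define b where "b n = a n + (1/2) ^ n" for n
  have a: "a n \<ge> 0" for n unfolding a_def by (rule INF_weight_prod_nonneg[OF assms(1)])
  have b: "b n \<ge> 0" for n by (simp add: b_def a)
  obtain \<kappa> where \<kappa>: "\<And>n. weight_prod w (Suc (\<kappa> n)) n < b n"
    using ex_weight_prod_near_INF[OF assms(1)] unfolding a_def b_def by blast
  have dom: "\<exists>k. norm (y k) \<ge> weight_prod w (Suc k) n" if "\<And>n. b n \<le> norm (y (\<kappa> n))"
    for n and y :: "nat \<Rightarrow> complex"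
    using \<kappa>[of n] that[of n] by (intro exI[of _ "\<kappa> n"]) simp
  have lp: "\<not> strongly_hypercyclic (lp_topology p) (backward_shift w)"
    if p: "1 \<le> p" and fin: "(\<Sum>n. ennreal (a (Suc n) powr p)) \<noteq> \<infinity>" for p
  proof -
    have "summable (\<lambda>n. a (Suc n) powr p)"
      using fin by (intro summable_suminf_not_top) (auto simp: infinity_ennreal_def)
    then have "summable (\<lambda>n. a n powr p)" by (subst (asm) summable_Suc_iff)
    then have "(\<lambda>n. complex_of_real (a n)) \<in> lp_space p" by (simp add: lp_space_def a)
    moreover have "(\<lambda>n. complex_of_real ((1/2) ^ n)) \<in> lp_space p"
    proof -
      have "(r ^ n) powr p = (r powr p) ^ n" if "r \<ge> 0" for r :: real and n
        using that by (induction n) (simp_all add: powr_mult)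
      from this[of "1/2"] have "((1/2) ^ n) powr p = ((1/2) powr p) ^ n" for n by simp
      moreover have "(1/2) powr p < (1::real)"
        using p powr_less_mono2[of p "1/2" 1] by simp
      ultimately show ?thesis
        by (simp add: lp_space_def norm_power norm_divide summable_geometric)
    qed
    ultimately have "(\<lambda>n. complex_of_real (a n)) + (\<lambda>n. complex_of_real ((1/2) ^ n)) \<in> lp_space p"
      by (rule lp_norm_triangle(1)[OF p])
    moreover have "norm (complex_of_real (a n) + complex_of_real ((1/2) ^ n)) = b n" for n
      using b[of n] unfolding b_def by (metis of_real_add norm_of_real abs_of_nonneg)
    ultimately have "summable (\<lambda>n. b n powr p)" by (simp add: lp_space_def)
    then obtain y where y: "y \<in> lp_space p" "\<And>n. b n \<le> norm (y (\<kappa> n))"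
      using lp_dominates_along_map[of p b \<kappa>] p b by blast
    show ?thesis
      by (rule not_strongly_hypercyclic_if_dominating[OF Metric_space_lp[OF p] _
            lp_norm_upper[OF p] assms(1) y(1) dom[OF y(2)]])
        (auto simp: lp_space_def)
  qed
  have c0: "\<not> strongly_hypercyclic c0_topology (backward_shift w)"
    if "\<not> limsup (\<lambda>n. ereal (a n)) > 0"
  proof -
    have "limsup (\<lambda>n. ereal (a n)) \<le> ereal 0" using that by (simp add: not_less zero_ereal_def)
    moreover have "ereal 0 \<le> liminf (\<lambda>n. ereal (a n))"
      using a by (intro Liminf_bounded always_eventually) simp
    ultimately have "a \<longlonglongrightarrow> 0" by (rule limsup_le_liminf_real)
    then have "b \<longlonglongrightarrow> 0"
      using tendsto_add[of a 0 sequentially "\<lambda>n. (1/2) ^ n" 0] LIMSEQ_realpow_zero[of "1/2"]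
      by (simp add: b_def[abs_def])
    then obtain y where y: "y \<in> c0_space" "\<And>n. b n \<le> norm (y (\<kappa> n))"
      using c0_dominates_along_map[of b \<kappa>] b by blast
    show ?thesis
      by (rule not_strongly_hypercyclic_if_dominating[OF Metric_space_c0 _
            c0_norm_upper assms(1) y(1) dom[OF y(2)]])
        (auto simp: c0_space_def zero_fun_def)
  qed
  show ?thesis using lp c0 unfolding a_def by blast
qed

end
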